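(* Let $\mathcal{B}$ be an arbitrary (finite or infinite) partition of non-impossible events. For every $B\in\mathcal{B}$ let $\mathcal{H}(B)$ be an arbitrary set of bounded random variables containing (the indicator of) $B$, let $\mathcal{D}_B=\{X|B: X\in\mathcal{H}(B)\}$, and let $\underline{P}_B:\mathcal{D}_B\to\mathbb{R}$ be a conditional lower prevision. Let $\mathcal{D}=\bigcup_{B\in\mathcal{B}}\mathcal{D}_B$ and define $\underline{P}:\mathcal{D}\to\mathbb{R}$ by $\underline{P}(X|B)=\underline{P}_B(X|B)$ for all $B\in\mathcal{B}$, $X\in\mathcal{H}(B)$. Then the lower previsions $\underline{P}_B$ $(B\in\mathcal{B})$ are separately coherent if and only if $\underline{P}$ is W-coherent on $\mathcal{D}$.
   Context: Conventions. A bounded random variable is a bounded map on a partition of non-impossible events $\omega$ (the atoms); all random variables and events considered together are described on a common, sufficiently fine partition. An event $B$ is identified with the set of atoms implying it, and the same symbol $B$ denotes its indicator function. A partition is a family of pairwise disjoint non-impossible events whose union is the sure event $\Omega$. For a non-impossible (non-empty) event $B$, the conditional random variable $X|B$ is the restriction of $X$ to the atoms implying $B$; so $X|B=Y|B$ iff $BX=BY$, and $\sup(X|B)=\sup_{\omega\Rightarrow B}X(\omega)$. A lower prevision is just a real-valued map on a set of bounded conditional random variables. Separate coherence. The $\underline{P}_B$ $(B\in\mathcal{B})$ are separately coherent iff for every $B\in\mathcal{B}$: (i) $\underline{P}_B(B|B)=1$; (ii) for all integers $n\ge 0$, all real $s_0,\dots,s_n\ge 0$ and all $X_0,\dots,X_n\in\mathcal{H}(B)$,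 putting $G=\sum_{i=1}^n s_i(X_i-\underline{P}_B(X_i|B))-s_0(X_0-\underline{P}_B(X_0|B))$, one has $\sup G\ge 0$ (unconditional supremum over all atoms). W-coherence. A map $\underline{P}:\mathcal{D}\to\mathbb{R}$ on a set $\mathcal{D}$ of bounded conditional random variables is W-coherent on $\mathcal{D}$ iff for all integers $n\ge 0$, all $X_0|B_0,\dots,X_n|B_n\in\mathcal{D}$ and all real $s_0,\dots,s_n\ge 0$, putting $B=\bigvee_{i=0}^n B_i$ and $G=\sum_{i=1}^n s_iB_i(X_i-\underline{P}(X_i|B_i))-s_0B_0(X_0-\underline{P}(X_0|B_0))$, one has $\sup(G|B)\ge 0$. *)

theory Defs
  imports "HOL-Analysis.Analysis"
begin

text \<open>
  The atoms are the elements of the type \<^typ>\<open>'a\<close>; events are sets of atoms, and the sure event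
  is \<^term>\<open>UNIV\<close>.  The conditional random variable X|B is the restriction of X to B, as a partial
  map: its domain recovers B, so X|B and Y|C are equal iff B = C and X, Y agree on B.
\<close>

definition cond_rv :: "('a \<Rightarrow> real) \<Rightarrow> 'a set \<Rightarrow> ('a \<rightharpoonup> real)" where
  "cond_rv X B = (\<lambda>\<omega>. Some (X \<omega>)) |` B"

lemma dom_cond_rv [simp]: "dom (cond_rv X B) = B"
  by (auto simp: cond_rv_def)

lemma cond_rv_eq_iff: "cond_rv X B = cond_rv Y C \<longleftrightarrow> B = C \<and> (\<forall>\<omega>\<in>B. X \<omega> = Y \<omega>)"
proof
  assume eq: "cond_rv X B = cond_rv Y C"
  then have "B = C" by (metis dom_cond_rv)
  moreover have "X \<omega> = Y \<omega>" if "\<omega> \<in> B" for \<omega>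
    using fun_cong[OF eq, of \<omega>] that \<open>B = C\<close> by (simp add: cond_rv_def)
  ultimately show "B = C \<and> (\<forall>\<omega>\<in>B. X \<omega> = Y \<omega>)" by blast
qed (auto simp: cond_rv_def restrict_map_def)

text \<open>
  A lower prevision is a total function on partial maps of which only the values on its domain
  (a set of conditional random variables) matter.  The suprema below are over nonempty sets of
  reals that are bounded above whenever the random variables involved are bounded.
\<close>

definition separately_coherent ::
  "'a set set \<Rightarrow> ('a set \<Rightarrow> ('a \<Rightarrow> real) set) \<Rightarrow> ('a set \<Rightarrow> ('a \<rightharpoonup> real) \<Rightarrow> real) \<Rightarrow> bool" where
  "separately_coherent \<B> H PB \<longleftrightarrow>
    (\<forall>B\<in>\<B>.
      PB B (cond_rv (indicator B) B) = 1 \<and>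
      (\<forall>(n::nat) (s::nat \<Rightarrow> real) (X::nat \<Rightarrow> 'a \<Rightarrow> real).
        (\<forall>i\<le>n. 0 \<le> s i) \<longrightarrow> (\<forall>i\<le>n. X i \<in> H B) \<longrightarrow>
        0 \<le> (SUP \<omega>. (\<Sum>i=1..n. s i * (X i \<omega> - PB B (cond_rv (X i) B)))
                    - s 0 * (X 0 \<omega> - PB B (cond_rv (X 0) B)))))"

definition W_coherent :: "('a \<rightharpoonup> real) set \<Rightarrow> (('a \<rightharpoonup> real) \<Rightarrow> real) \<Rightarrow> bool" where
  "W_coherent D P \<longleftrightarrow>
    (\<forall>(n::nat) (s::nat \<Rightarrow> real) (X::nat \<Rightarrow> 'a \<Rightarrow> real) (B::nat \<Rightarrow> 'a set).
      (\<forall>i\<le>n. 0 \<le> s i) \<longrightarrow> (\<forall>i\<le>n. cond_rv (X i) (B i) \<in> D) \<longrightarrow>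
      0 \<le> (SUP \<omega>\<in>(\<Union>i\<le>n. B i).
             (\<Sum>i=1..n. s i * indicator (B i) \<omega> * (X i \<omega> - P (cond_rv (X i) (B i))))
             - s 0 * indicator (B 0) \<omega> * (X 0 \<omega> - P (cond_rv (X 0) (B 0)))))"

end

theory Submission
  imports Defs
begin

text \<open>
  Both notions of coherence ask that no combination of bets, all but one of them bought and one sold,
  loses uniformly.  They differ in two ways: separate coherence works with one conditioning
  event \<open>B\<close> at a time and lets the bets run on all atoms, whereas W-coherence mixes conditioning
  events and calls each bet off outside its own event.

  Passing from W-coherence to separate coherence only enlarges the set over which the supremum
  is taken, from \<open>B\<close> to the sure event; the normalisation of \<open>B|B\<close>
  comes from buying and from selling the bet on \<open>B\<close>, whose gain is constant on \<open>B\<close>.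

  In the other direction, two events of a partition are equal or disjoint.  On the event \<open>B\<close>
  that conditions the sold bet, the combined gain is therefore the gain of the bets conditional
  on \<open>B\<close> alone, and it suffices to bound the supremum over \<open>B\<close>.  Separate coherence
  speaks of the supremum over all atoms, but it can be localised to \<open>B\<close>: since \<open>B|B\<close>
  has prevision 1, one may buy \<open>K\<close> further units of the bet \<open>B - 1\<close>, which costs nothing on
  \<open>B\<close> and loses \<open>K\<close> outside.  As the gain is bounded, for large \<open>K\<close> the atoms outside
  \<open>B\<close> no longer contribute (lemma \<open>SUP_nonneg_localise\<close>).
\<close>

text \<open>
  Here \<open>Z i\<close> is a net outcome, price already deducted: \<open>X - P(X|B)\<close> yields the plain gain of
  separate coherence, and \<open>B (X - P(X|B))\<close> the called-off gain of W-coherence.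
\<close>

definition gain :: "nat \<Rightarrow> (nat \<Rightarrow> real) \<Rightarrow> (nat \<Rightarrow> 'a \<Rightarrow> real) \<Rightarrow> 'a \<Rightarrow> real" where
  "gain n s Z \<omega> = (\<Sum>i=1..n. s i * Z i \<omega>) - s 0 * Z 0 \<omega>"

lemma gain_cong:
  assumes "\<And>i. i \<le> n \<Longrightarrow> s i * Z i \<omega> = t i * W i \<omega>"
  shows "gain n s Z \<omega> = gain n t W \<omega>"
proof -
  have "(\<Sum>i=1..n. s i * Z i \<omega>) = (\<Sum>i=1..n. t i * W i \<omega>)"
    using assms by (intro sum.cong) auto
  then show ?thesis
    using assms[of 0] by (simp add: gain_def)
qed

lemma gain_Suc: "gain (Suc n) s Z \<omega> = gain n s Z \<omega> + s (Suc n) * Z (Suc n) \<omega>"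
  by (simp add: gain_def)

lemma bounded_range_gain:
  assumes "\<And>i. i \<le> n \<Longrightarrow> bounded (range (Z i))"
  shows "bounded (range (gain n s Z))"
  using assms
proof (induction n)
  case 0
  then obtain M where "\<And>\<omega>. \<bar>Z 0 \<omega>\<bar> \<le> M"
    by (auto simp: bounded_iff)
  then have "\<bar>gain 0 s Z \<omega>\<bar> \<le> \<bar>s 0\<bar> * M" for \<omega>
    by (simp add: gain_def abs_mult mult_left_mono)
  then show ?case
    by (auto simp: bounded_iff)
next
  case (Suc n)
  obtain M where M: "\<And>\<omega>. \<bar>gain n s Z \<omega>\<bar> \<le> M"
    using Suc by (fastforce simp: bounded_iff)
  obtain N where N: "\<And>\<omega>. \<bar>Z (Suc n) \<omega>\<bar> \<le> N"
    using Suc.prems[of "Suc n"] by (auto simp: bounded_iff)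
  have "\<bar>gain (Suc n) s Z \<omega>\<bar> \<le> M + \<bar>s (Suc n)\<bar> * N" for \<omega>
  proof -
    have "\<bar>s (Suc n) * Z (Suc n) \<omega>\<bar> \<le> \<bar>s (Suc n)\<bar> * N"
      using N by (simp add: abs_mult mult_left_mono)
    then show ?thesis
      unfolding gain_Suc using M[of \<omega>] by linarith
  qed
  then show ?case
    by (auto simp: bounded_iff)
qed

lemma SUP_nonneg_mono:
  fixes f :: "'a \<Rightarrow> real"
  assumes "bdd_above (f ` B)" and "A \<noteq> {}" and "A \<subseteq> B" and "0 \<le> (SUP \<omega>\<in>A. f \<omega>)"
  shows "0 \<le> (SUP \<omega>\<in>B. f \<omega>)"
  using assms cSUP_subset_mono[of A f B f] by force

text \<open>
  The penalty term vanishes on \<open>B\<close>, and outside it pushes the function down to at most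
  \<open>M - K < 0\<close>; so a nonnegative supremum has to be attained or approached within \<open>B\<close>.
\<close>

lemma SUP_nonneg_localise:
  fixes f :: "'a \<Rightarrow> real"
  assumes M: "\<And>\<omega>. f \<omega> \<le> M" and "M < K" and "B \<noteq> {}"
    and sup: "0 \<le> (SUP \<omega>. f \<omega> + K * (indicator B \<omega> - 1))"
  shows "0 \<le> (SUP \<omega>\<in>B. f \<omega>)"
proof (rule ccontr)
  assume neg: "\<not> 0 \<le> (SUP \<omega>\<in>B. f \<omega>)"
  have bdd: "bdd_above (f ` B)"
    using M by (rule bdd_aboveI2)
  have "(SUP \<omega>. f \<omega> + K * (indicator B \<omega> - 1)) \<le> max (SUP \<omega>\<in>B. f \<omega>) (M - K)"
  proof (rule cSUP_least)
    show "f \<omega> + K * (indicator B \<omega> - 1) \<le> max (SUP \<omega>\<in>B. f \<omega>) (M - K)" for \<omega>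
    proof (cases "\<omega> \<in> B")
      case True
      then show ?thesis
        using cSUP_upper[OF True bdd] by simp
    next
      case False
      then show ?thesis
        using M[of \<omega>] by simp
    qed
  qed simp
  then show False
    using sup neg \<open>M < K\<close> by linarith
qed

lemma separately_coherent_gain:
  "separately_coherent \<B> H PB \<longleftrightarrow>
    (\<forall>B\<in>\<B>. PB B (cond_rv (indicator B) B) = 1 \<and>
      (\<forall>n s X. (\<forall>i\<le>n. 0 \<le> s i) \<longrightarrow> (\<forall>i\<le>n. X i \<in> H B) \<longrightarrow>
        0 \<le> (SUP \<omega>. gain n s (\<lambda>i \<omega>. X i \<omega> - PB B (cond_rv (X i) B)) \<omega>)))"
  by (simp add: separately_coherent_def gain_def)

lemma W_coherent_gain:
  "W_coherent D P \<longleftrightarrow>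
    (\<forall>n s X B. (\<forall>i\<le>n. 0 \<le> s i) \<longrightarrow> (\<forall>i\<le>n. cond_rv (X i) (B i) \<in> D) \<longrightarrow>
      0 \<le> (SUP \<omega>\<in>(\<Union>i\<le>n. B i).
             gain n s (\<lambda>i \<omega>. indicator (B i) \<omega> * (X i \<omega> - P (cond_rv (X i) (B i)))) \<omega>))"
  by (simp add: W_coherent_def gain_def mult.assoc)

lemma bounded_range_diff_const:
  fixes X :: "'a \<Rightarrow> real"
  assumes "bounded (range X)"
  shows "bounded (range (\<lambda>\<omega>. X \<omega> - c))"
  using bounded_minus_comp[of X UNIV "\<lambda>_. c"] assms by simp

text \<open>
  This is the localisation step for separate coherence: the bets are completed by a further one
  on \<open>B\<close> itself, bought at its price 1 with a stake exceeding every possible gain.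
\<close>

lemma separately_coherent_SUP_on:
  assumes coh: "separately_coherent \<B> H PB" and B: "B \<in> \<B>" "B \<noteq> {}"
    and ind: "indicator B \<in> H B"
    and bdd: "\<And>X. X \<in> H B \<Longrightarrow> bounded (range X)"
    and s: "\<And>i. i \<le> n \<Longrightarrow> 0 \<le> s i" and X: "\<And>i. i \<le> n \<Longrightarrow> X i \<in> H B"
  shows "0 \<le> (SUP \<omega>\<in>B. gain n s (\<lambda>i \<omega>. X i \<omega> - PB B (cond_rv (X i) B)) \<omega>)"
proof -
  define Z where "Z X = (\<lambda>\<omega>. X \<omega> - PB B (cond_rv X B))" for X
  have "bounded (range (gain n s (\<lambda>i. Z (X i))))"
    using X bdd unfolding Z_def by (intro bounded_range_gain bounded_range_diff_const) auto
  then obtain M where M: "\<And>\<omega>. \<bar>gain n s (\<lambda>i. Z (X i)) \<omega>\<bar> \<le> M"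
    by (auto simp: bounded_iff)
  have M0: "0 \<le> M"
    using order_trans[OF abs_ge_zero M] .
  define t where "t = s(Suc n := M + 1)"
  define Y where "Y = X(Suc n := indicator B)"
  have "\<forall>i\<le>Suc n. 0 \<le> t i" and "\<forall>i\<le>Suc n. Y i \<in> H B"
    using s X ind M0 by (auto simp: t_def Y_def le_Suc_eq)
  then have "0 \<le> (SUP \<omega>. gain (Suc n) t (\<lambda>i. Z (Y i)) \<omega>)"
    using coh B unfolding separately_coherent_gain Z_def by blast
  moreover have "gain (Suc n) t (\<lambda>i. Z (Y i)) \<omega> =
      gain n s (\<lambda>i. Z (X i)) \<omega> + (M + 1) * (indicator B \<omega> - 1)" for \<omega>
  proof -
    have "gain n t (\<lambda>i. Z (Y i)) \<omega> = gain n s (\<lambda>i. Z (X i)) \<omega>"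
      by (rule gain_cong) (simp add: t_def Y_def)
    moreover have "PB B (cond_rv (indicator B) B) = 1"
      using coh B by (simp add: separately_coherent_gain)
    ultimately show ?thesis
      by (simp add: gain_Suc t_def Y_def Z_def)
  qed
  ultimately have "0 \<le> (SUP \<omega>. gain n s (\<lambda>i. Z (X i)) \<omega> + (M + 1) * (indicator B \<omega> - 1))"
    by simp
  then have "0 \<le> (SUP \<omega>\<in>B. gain n s (\<lambda>i. Z (X i)) \<omega>)"
    using M B(2) abs_le_D1
    by (intro SUP_nonneg_localise[where M = M and K = "M + 1" and B = B]) auto
  then show ?thesis
    by (simp add: Z_def)
qed

theorem proposition5:
  fixes \<B> :: "'a set set"
    and H :: "'a set \<Rightarrow> ('a \<Rightarrow> real) set"
    and DB :: "'a set \<Rightarrow> ('a \<rightharpoonup> real) set"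
    and PB :: "'a set \<Rightarrow> ('a \<rightharpoonup> real) \<Rightarrow> real"
    and D :: "('a \<rightharpoonup> real) set"
    and P :: "('a \<rightharpoonup> real) \<Rightarrow> real"
  assumes "partition_on UNIV \<B>"
    and "\<And>B X. B \<in> \<B> \<Longrightarrow> X \<in> H B \<Longrightarrow> bounded (range X)"
    and "\<And>B. B \<in> \<B> \<Longrightarrow> indicator B \<in> H B"
    and "\<And>B. B \<in> \<B> \<Longrightarrow> DB B = {cond_rv X B | X. X \<in> H B}"
    and "D = (\<Union>B\<in>\<B>. DB B)"
    and "\<And>B X. B \<in> \<B> \<Longrightarrow> X \<in> H B \<Longrightarrow> P (cond_rv X B) = PB B (cond_rv X B)"
  shows "separately_coherent \<B> H PB \<longleftrightarrow> W_coherent D P"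
proof -
  note ne = partition_onD3[OF assms(1)]
  have mem_D: "c \<in> D \<longleftrightarrow> (\<exists>B\<in>\<B>. \<exists>X\<in>H B. c = cond_rv X B)" for c
    using assms(4,5) by auto
  show ?thesis
  proof
    assume coh: "separately_coherent \<B> H PB"
    show "W_coherent D P"
      unfolding W_coherent_gain
    proof (intro allI impI)
      fix n :: nat and s :: "nat \<Rightarrow> real" and X :: "nat \<Rightarrow> 'a \<Rightarrow> real" and B :: "nat \<Rightarrow> 'a set"
      assume s: "\<forall>i\<le>n. 0 \<le> s i" and XD: "\<forall>i\<le>n. cond_rv (X i) (B i) \<in> D"
      \<comment> \<open>Membership in \<open>D\<close> constrains \<open>X i\<close> on \<open>B i\<close> only, so \<open>X i\<close> is replaced by an element of
         \<open>H (B i)\<close>, bounded on all atoms, with the same restriction to \<open>B i\<close>.\<close>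
      have "\<forall>i\<in>{..n}. \<exists>Y. B i \<in> \<B> \<and> Y \<in> H (B i) \<and> cond_rv (X i) (B i) = cond_rv Y (B i)"
        using XD by (fastforce simp: mem_D cond_rv_eq_iff)
      then obtain Y where Y: "\<And>i. i \<le> n \<Longrightarrow>
          B i \<in> \<B> \<and> Y i \<in> H (B i) \<and> cond_rv (X i) (B i) = cond_rv (Y i) (B i)"
        by (metis atMost_iff)
      have X_eq_Y: "indicator (B i) \<omega> * (X i \<omega> - P (cond_rv (X i) (B i))) =
          indicator (B i) \<omega> * (Y i \<omega> - PB (B i) (cond_rv (Y i) (B i)))" if "i \<le> n" for i \<omega>
      proof -
        have "P (cond_rv (X i) (B i)) = PB (B i) (cond_rv (Y i) (B i))"
          using Y[OF that] assms(6)[of "B i" "Y i"] by simp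
        moreover have "X i \<omega> = Y i \<omega>" if "\<omega> \<in> B i"
          using Y[OF \<open>i \<le> n\<close>] that by (simp add: cond_rv_eq_iff)
        ultimately show ?thesis
          by (simp add: indicator_def)
      qed
      define g where
        "g = gain n s (\<lambda>i \<omega>. indicator (B i) \<omega> * (Y i \<omega> - PB (B i) (cond_rv (Y i) (B i))))"
      have g: "gain n s (\<lambda>i \<omega>. indicator (B i) \<omega> * (X i \<omega> - P (cond_rv (X i) (B i)))) = g"
        unfolding g_def using X_eq_Y by (intro ext gain_cong) simp

      have "bounded (range g)"
        unfolding g_def
      proof (rule bounded_range_gain)
        fix i assume "i \<le> n"
        then have "bounded (range (\<lambda>\<omega>. Y i \<omega> - PB (B i) (cond_rv (Y i) (B i))))"
          using Y assms(2) by (intro bounded_range_diff_const) auto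
        then show "bounded (range (\<lambda>\<omega>. indicator (B i) \<omega> * (Y i \<omega> - PB (B i) (cond_rv (Y i) (B i)))))"
          unfolding bounded_iff by (fastforce simp: indicator_def)
      qed
      then have bdd: "bdd_above (g ` (\<Union>i\<le>n. B i))"
        by (meson bdd_above_mono bounded_imp_bdd_above image_mono subset_UNIV)

      have B0: "B 0 \<in> \<B>" "B 0 \<noteq> {}"
        using Y[of 0] ne by auto
      \<comment> \<open>Bets conditional on events other than \<open>B 0\<close> are called off on \<open>B 0\<close>; giving them stake
         zero there keeps the numbering, and \<open>indicator (B 0)\<close> fills their places within \<open>H (B 0)\<close>.\<close>
      define t where "t i = (if B i = B 0 then s i else 0)" for i
      define W where "W i = (if B i = B 0 then Y i else indicator (B 0))" for i
      have "g \<omega> = gain n t (\<lambda>i \<omega>. W i \<omega> - PB (B 0) (cond_rv (W i) (B 0))) \<omega>"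
        if "\<omega> \<in> B 0" for \<omega>
        unfolding g_def
      proof (rule gain_cong)
        fix i assume "i \<le> n"
        then have "B i = B 0 \<or> \<omega> \<notin> B i"
          using Y B0 that partition_onD2[OF assms(1)] by (auto dest: disjointD)
        then show "s i * (indicator (B i) \<omega> * (Y i \<omega> - PB (B i) (cond_rv (Y i) (B i)))) =
            t i * (W i \<omega> - PB (B 0) (cond_rv (W i) (B 0)))"
          using that by (auto simp: t_def W_def)
      qed
      moreover have
        "0 \<le> (SUP \<omega>\<in>B 0. gain n t (\<lambda>i \<omega>. W i \<omega> - PB (B 0) (cond_rv (W i) (B 0))) \<omega>)"
      proof (rule separately_coherent_SUP_on[OF coh B0])
        show "indicator (B 0) \<in> H (B 0)"
          using assms(3) B0 by simp
        show "bounded (range X)" if "X \<in> H (B 0)" for X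
          using assms(2) B0 that by blast
        show "0 \<le> t i" if "i \<le> n" for i
          using s that by (simp add: t_def)
        show "W i \<in> H (B 0)" if "i \<le> n" for i
          using Y[OF that] assms(3) B0 by (auto simp: W_def)
      qed
      ultimately have "0 \<le> (SUP \<omega>\<in>B 0. g \<omega>)"
        by simp
      then show "0 \<le> (SUP \<omega>\<in>(\<Union>i\<le>n. B i).
          gain n s (\<lambda>i \<omega>. indicator (B i) \<omega> * (X i \<omega> - P (cond_rv (X i) (B i)))) \<omega>)"
        unfolding g using B0 by (intro SUP_nonneg_mono[OF bdd, of "B 0"]) auto
    qed
  next
    assume W: "W_coherent D P"
    show "separately_coherent \<B> H PB"
      unfolding separately_coherent_gain
    proof (intro ballI conjI allI impI)
      fix B assume B: "B \<in> \<B>"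
      then have "B \<noteq> {}"
        using ne by auto
      \<comment> \<open>When all conditioning events are \<open>B\<close>, W-coherence bounds the supremum over \<open>B\<close>, where
         the called-off gain is the plain one.\<close>
      have on_B: "0 \<le> (SUP \<omega>\<in>B. gain n s (\<lambda>i \<omega>. X i \<omega> - PB B (cond_rv (X i) B)) \<omega>)"
        if s: "\<forall>i\<le>n. 0 \<le> s i" and X: "\<forall>i\<le>n. X i \<in> H B"
        for n :: nat and s :: "nat \<Rightarrow> real" and X :: "nat \<Rightarrow> 'a \<Rightarrow> real"
      proof -
        have "\<forall>i\<le>n. cond_rv (X i) B \<in> D"
          using B X by (auto simp: mem_D)
        then have "0 \<le> (SUP \<omega>\<in>(\<Union>i\<le>n. B).
            gain n s (\<lambda>i \<omega>. indicator B \<omega> * (X i \<omega> - P (cond_rv (X i) B))) \<omega>)"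
          using W[unfolded W_coherent_gain, rule_format, of n s X "\<lambda>_. B"] s by simp
        moreover have "gain n s (\<lambda>i \<omega>. indicator B \<omega> * (X i \<omega> - P (cond_rv (X i) B))) \<omega> =
            gain n s (\<lambda>i \<omega>. X i \<omega> - PB B (cond_rv (X i) B)) \<omega>" if "\<omega> \<in> B" for \<omega>
          using that B X assms(6) by (intro gain_cong) simp
        ultimately show ?thesis
          by simp
      qed
      show "PB B (cond_rv (indicator B) B) = 1"
      proof (rule antisym)
        let ?p = "PB B (cond_rv (indicator B) B)"
        have const: "(SUP \<omega>\<in>B. c * (indicator B \<omega> - ?p)) = c * (1 - ?p)" for c :: real
          using \<open>B \<noteq> {}\<close> by simp
        \<comment> \<open>Index 0 is the sold bet: \<open>n = 0\<close> sells the bet on \<open>B\<close>, while \<open>n = 1\<close> with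
           stake zero at index 0 buys it.\<close>
        show "1 \<le> ?p"
          using on_B[of 0 "\<lambda>_. 1" "\<lambda>_. indicator B"] assms(3)[OF B] const[of "-1"]
          by (simp add: gain_def)
        show "?p \<le> 1"
          using on_B[of 1 "\<lambda>i. of_nat i" "\<lambda>_. indicator B"] assms(3)[OF B] const[of 1]
          by (simp add: gain_def)
      qed
      fix n :: nat and s :: "nat \<Rightarrow> real" and X :: "nat \<Rightarrow> 'a \<Rightarrow> real"
      assume s: "\<forall>i\<le>n. 0 \<le> s i" and X: "\<forall>i\<le>n. X i \<in> H B"
      have "bounded (range (gain n s (\<lambda>i \<omega>. X i \<omega> - PB B (cond_rv (X i) B))))"
        using X B assms(2) by (intro bounded_range_gain bounded_range_diff_const) auto
      then show "0 \<le> (SUP \<omega>. gain n s (\<lambda>i \<omega>. X i \<omega> - PB B (cond_rv (X i) B)) \<omega>)"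
        using on_B[OF s X] \<open>B \<noteq> {}\<close>
        by (intro SUP_nonneg_mono[of _ UNIV B] bounded_imp_bdd_above) auto
    qed
  qed
qed

end
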